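(* Let $k$ be a positive integer, let $G$ be a graph, let $A\in\mathcal{S}(G)$, and let $p(x)\in\mathbb{R}_k[x]$ be a polynomial such that $p(A)$ is positive semidefinite and $\mathrm{tr}\,p(A)>0$. Then $$\vartheta(\overline{G^k})\geq\frac{e^\top p(A)e}{\mathrm{tr}\,p(A)},$$ where $e$ is the all-ones vector. Furthermore, if $p(A)$ is (entrywise) nonnegative, then $$\vartheta'(\overline{G^k})\geq\frac{e^\top p(A)e}{\mathrm{tr}\,p(A)}.$$
   Context: Graphs are finite, simple, undirected, with nonempty vertex set. $d(i,j)$ denotes the distance between vertices $i$ and $j$ in $G$ (with $d(i,j)=\infty$ if they lie in different components). The power graph $G^k$ has the same vertices as $G$, two distinct vertices being adjacent iff they are at distance at most $k$ in $G$. $\overline{H}$ denotes the complement of a graph $H$. $\mathbb{R}_k[x]$ is the set of real polynomials of degree at most $k$. $\mathcal{S}(G)$ is the set of real symmetric matrices $A$ indexed by the vertices of $G$ such that $(A)_{ij}=0$ whenever $d(i,j)>1$ (diagonal entries are arbitrary). Lovász theta function: an orthonormal representation of a graph $H$ with vertex set $\{1,\ldots,n\}$ is a set of unit real vectors $\{u_1,\ldots,u_n\}$ (in some Euclidean space) with $u_i^\top u_j=0$ whenever $i,j$ are distinct nonadjacent vertices; its value is $\min_c\max_{1\le i\le n}\frac{1}{(c^\top u_i)^2}$, with $c$ ranging over all unit real vectors; $\vartheta(H)$ is the minimum value over all orthonormal representations of $H$. By a theorem of Lovász (1979), which may be taken as known, $\vartheta(H)=\max_B e^\top Be$, where $B$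 ranges over all positive semidefinite real $n\times n$ matrices with $\mathrm{tr}\,B=1$ and $(B)_{ij}=0$ for every $\{i,j\}\in E(H)$. Schrijver theta function: $\vartheta'(H)=\max_B e^\top Be$, where $B$ ranges over all positive semidefinite, entrywise nonnegative real $n\times n$ matrices with $\mathrm{tr}\,B=1$ and $(B)_{ij}=0$ for every $\{i,j\}\in E(H)$. *)

theory Defs
  imports
    "HOL-Analysis.Analysis"
    "HOL-Computational_Algebra.Polynomial"
    "HOL-Library.Extended_Nat"
begin

section \<open>Graphs\<close>

text \<open>
  A graph is given by its adjacency relation; the vertex set is the whole of a finite type, which is
  automatically nonempty.
\<close>

definition simple_graph :: "('n::finite \<Rightarrow> 'n \<Rightarrow> bool) \<Rightarrow> bool" where
  "simple_graph G \<longleftrightarrow> symp G \<and> irreflp G"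

text \<open>
  Here \<open>(G ^^ l) i j\<close> says that there is a walk of length \<open>l\<close> from \<open>i\<close> to \<open>j\<close>. If there is no walk
  at all, the infimum is over the empty set and the distance is \<open>\<infinity>\<close>.
\<close>

definition graph_dist :: "('n::finite \<Rightarrow> 'n \<Rightarrow> bool) \<Rightarrow> 'n \<Rightarrow> 'n \<Rightarrow> enat" where
  "graph_dist G i j = (INF l\<in>{l. (G ^^ l) i j}. enat l)"

definition graph_power :: "('n::finite \<Rightarrow> 'n \<Rightarrow> bool) \<Rightarrow> nat \<Rightarrow> 'n \<Rightarrow> 'n \<Rightarrow> bool" where
  "graph_power G k i j \<longleftrightarrow> i \<noteq> j \<and> graph_dist G i j \<le> enat k"

definition graph_complement :: "('n::finite \<Rightarrow> 'n \<Rightarrow> bool) \<Rightarrow> 'n \<Rightarrow> 'n \<Rightarrow> bool" where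
  "graph_complement G i j \<longleftrightarrow> i \<noteq> j \<and> \<not> G i j"

section \<open>Matrices\<close>

definition graph_matrices :: "('n::finite \<Rightarrow> 'n \<Rightarrow> bool) \<Rightarrow> (real ^ 'n ^ 'n) set" where
  "graph_matrices G =
     {A. transpose A = A \<and> (\<forall>i j. graph_dist G i j > 1 \<longrightarrow> A $ i $ j = 0)}"

text \<open>The type class power \<open>A ^ l\<close> is taken componentwise, so matrix powers are iterated products.\<close>

primrec matrix_power :: "real ^ 'n ^ 'n \<Rightarrow> nat \<Rightarrow> real ^ 'n ^ 'n" where
  "matrix_power A 0 = mat 1"
| "matrix_power A (Suc l) = A ** matrix_power A l"

definition poly_matrix :: "real poly \<Rightarrow> real ^ 'n ^ 'n \<Rightarrow> real ^ 'n ^ 'n" where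
  "poly_matrix p A = (\<Sum>l\<le>degree p. coeff p l *\<^sub>R matrix_power A l)"

definition psd_matrix :: "real ^ 'n ^ 'n \<Rightarrow> bool" where
  "psd_matrix B \<longleftrightarrow> transpose B = B \<and> (\<forall>x. 0 \<le> x \<bullet> (B *v x))"

definition nonneg_matrix :: "real ^ 'n ^ 'n \<Rightarrow> bool" where
  "nonneg_matrix B \<longleftrightarrow> (\<forall>i j. 0 \<le> B $ i $ j)"

text \<open>The sum \<open>e\<^sup>T B e\<close> of all entries; \<open>1 :: real ^ 'n\<close> is the all-ones vector.\<close>

definition ones_form :: "real ^ 'n ^ 'n \<Rightarrow> real" where
  "ones_form B = 1 \<bullet> (B *v 1)"

section \<open>The Lovasz theta function\<close>

text \<open>
  The dimension \<open>d\<close> of the Euclidean space is not fixed, so vectors of that space are functions on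
  the naturals of which only the coordinates below \<open>d\<close> are used.
\<close>

definition inner_dim :: "nat \<Rightarrow> (nat \<Rightarrow> real) \<Rightarrow> (nat \<Rightarrow> real) \<Rightarrow> real" where
  "inner_dim d x y = (\<Sum>m<d. x m * y m)"

definition unit_dim :: "nat \<Rightarrow> (nat \<Rightarrow> real) \<Rightarrow> bool" where
  "unit_dim d x \<longleftrightarrow> sqrt (inner_dim d x x) = 1"

definition orthonormal_rep ::
  "('n::finite \<Rightarrow> 'n \<Rightarrow> bool) \<Rightarrow> nat \<Rightarrow> ('n \<Rightarrow> nat \<Rightarrow> real) \<Rightarrow> bool" where
  "orthonormal_rep H d u \<longleftrightarrow>
     (\<forall>i. unit_dim d (u i)) \<and>
     (\<forall>i j. i \<noteq> j \<longrightarrow> \<not> H i j \<longrightarrow> inner_dim d (u i) (u j) = 0)"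

text \<open>
  Division takes place in \<^typ>\<open>ereal\<close>, where \<open>1 / 0 = \<infinity>\<close>: a vector \<open>c\<close> orthogonal to some \<open>u i\<close>
  gives the value \<open>\<infinity>\<close> (over the reals it would give the wrong value \<open>0\<close>). Both infima are minima
  (by compactness, since the dimension can be bounded in terms of the number of vertices).
\<close>

definition rep_value :: "nat \<Rightarrow> ('n::finite \<Rightarrow> nat \<Rightarrow> real) \<Rightarrow> ereal" where
  "rep_value d u =
     (INF c\<in>{c. unit_dim d c}. MAX i\<in>UNIV. 1 / ereal ((inner_dim d c (u i))\<^sup>2))"

definition lovasz_theta :: "('n::finite \<Rightarrow> 'n \<Rightarrow> bool) \<Rightarrow> real" where
  "lovasz_theta H =
     real_of_ereal (INF (d, u)\<in>{(d, u). orthonormal_rep H d u}. rep_value d u)"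

text \<open>The infimum is finite, so the conversion to a real number is harmless.\<close>

lemma ereal_lovasz_theta:
  fixes H :: "'n::finite \<Rightarrow> 'n \<Rightarrow> bool"
  shows "ereal (lovasz_theta H) =
    (INF (d, u)\<in>{(d, u). orthonormal_rep H d u}. rep_value d u)" (is "_ = ?I")
proof -
  let ?n = "CARD('n)"
  obtain f :: "'n \<Rightarrow> nat" where f: "bij_betw f UNIV {..<?n}"
    using ex_bij_betw_finite_nat[of "UNIV :: 'n set"] by (auto simp: atLeast0LessThan)
  have fl: "f i < ?n" for i
    using f by (auto simp: bij_betw_def)
  have fi: "f i = f j \<longleftrightarrow> i = j" for i j
    using f by (auto simp: bij_betw_def inj_on_def)
  define u :: "'n \<Rightarrow> nat \<Rightarrow> real" where "u = (\<lambda>i m. if m = f i then 1 else 0)"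
  define c :: "nat \<Rightarrow> real" where "c = (\<lambda>_. 1 / sqrt ?n)"
  have uu: "inner_dim ?n x (u i) = x (f i)" for x i
    using fl[of i] by (simp add: inner_dim_def u_def if_distrib cong: if_cong)
  have rep: "orthonormal_rep H ?n u"
    by (simp add: orthonormal_rep_def unit_dim_def uu, simp add: u_def fi)
  have c: "unit_dim ?n c"
    by (simp add: unit_dim_def inner_dim_def c_def)
  have "?I \<le> rep_value ?n u"
    by (rule INF_lower2[of "(?n, u)"]) (use rep in auto)
  also have "\<dots> \<le> (MAX i\<in>UNIV. 1 / ereal ((inner_dim ?n c (u i))\<^sup>2))"
    unfolding rep_value_def by (rule INF_lower) (use c in simp)
  also have "\<dots> = ereal ?n"
    by (simp add: uu c_def power_divide one_ereal_def)
  finally have "?I \<le> ereal ?n" .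
  moreover have "0 \<le> rep_value d v" for d and v :: "'n \<Rightarrow> nat \<Rightarrow> real"
    unfolding rep_value_def by (rule INF_greatest) (auto simp: Max_ge_iff)
  then have "0 \<le> ?I"
    by (auto intro!: INF_greatest)
  ultimately show ?thesis
    unfolding lovasz_theta_def by (intro ereal_real') auto
qed

section \<open>The Schrijver theta function\<close>

definition schrijver_feasible :: "('n::finite \<Rightarrow> 'n \<Rightarrow> bool) \<Rightarrow> (real ^ 'n ^ 'n) set" where
  "schrijver_feasible H =
     {B. psd_matrix B \<and> nonneg_matrix B \<and> trace B = 1 \<and> (\<forall>i j. H i j \<longrightarrow> B $ i $ j = 0)}"

definition schrijver_theta :: "('n::finite \<Rightarrow> 'n \<Rightarrow> bool) \<Rightarrow> real" where
  "schrijver_theta H = (SUP B\<in>schrijver_feasible H. ones_form B)"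

text \<open>
  The supremum is over a bounded set, nonempty when \<open>H\<close> has no loops; it is a maximum, by
  compactness.
\<close>

lemma schrijver_feasible_nonempty:
  fixes H :: "'n::finite \<Rightarrow> 'n \<Rightarrow> bool"
  assumes "irreflp H"
  shows "schrijver_feasible H \<noteq> {}"
proof -
  let ?B = "mat (1 / CARD('n)) :: real ^ 'n ^ 'n"
  have "?B *v x = (1 / CARD('n)) *\<^sub>R x" for x
    by (simp add: vec_eq_iff matrix_vector_mult_def mat_def if_distrib[of "\<lambda>y. y * _"] cong: if_cong)
  then have "psd_matrix ?B"
    by (simp add: psd_matrix_def)
  moreover have "nonneg_matrix ?B" "trace ?B = 1"
    by (auto simp: nonneg_matrix_def trace_def mat_def)
  moreover have "?B $ i $ j = 0" if "H i j" for i j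
    using that assms by (auto simp: mat_def irreflp_def)
  ultimately show ?thesis
    unfolding schrijver_feasible_def by blast
qed

lemma schrijver_bdd_above:
  fixes H :: "'n::finite \<Rightarrow> 'n \<Rightarrow> bool"
  shows "bdd_above (ones_form ` schrijver_feasible H)"
proof (rule bdd_aboveI2)
  fix B assume "B \<in> schrijver_feasible H"
  then have B: "transpose B = B" "\<And>x. 0 \<le> x \<bullet> (B *v x)" "trace B = 1"
    by (auto simp: schrijver_feasible_def psd_matrix_def)
  have sym: "B $ j $ i = B $ i $ j" for i j
    using B(1) by (metis transpose_def vec_lambda_beta)
  have entry: "2 * B $ i $ j \<le> B $ i $ i + B $ j $ j" for i j
  proof -
    have ax: "axis a 1 \<bullet> (B *v axis b 1) = B $ a $ b" for a b
      by (simp add: inner_axis' column_def matrix_vector_mul_component inner_axis)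
    have "0 \<le> (axis i 1 - axis j 1) \<bullet> (B *v (axis i 1 - axis j 1))"
      by (rule B(2))
    also have "\<dots> = B $ i $ i - B $ i $ j - (B $ j $ i - B $ j $ j)"
      by (simp add: matrix_vector_mult_diff_distrib inner_diff_left inner_diff_right ax)
    finally show ?thesis using sym[of i j] by simp
  qed
  have "2 * ones_form B = (\<Sum>i\<in>UNIV. \<Sum>j\<in>UNIV. 2 * B $ i $ j)"
    by (simp add: ones_form_def inner_vec_def matrix_vector_mult_def sum_distrib_left)
  also have "\<dots> \<le> (\<Sum>i\<in>UNIV. \<Sum>j\<in>UNIV. B $ i $ i + B $ j $ j)"
    by (intro sum_mono entry)
  also have "\<dots> = 2 * CARD('n) * trace B"
    by (simp add: sum.distrib trace_def sum_distrib_left mult.assoc)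
  finally show "ones_form B \<le> CARD('n)"
    using B(3) by simp
qed

end

theory Submission
  imports Defs
begin

text \<open>
  Since \<open>p(A)\<close> is supported on pairs at distance at most \<open>k\<close>, the matrix \<open>p(A) / tr p(A)\<close> is feasible
  in the dual problems of both theta functions. For \<open>\<vartheta>'\<close> this is the claim. For \<open>\<vartheta>\<close> only weak duality
  is needed: given an orthonormal representation \<open>u\<close>, a unit vector \<open>c\<close> and a feasible \<open>B\<close>, put
  \<open>v\<^sub>i = u\<^sub>i / (c\<^sup>T u\<^sub>i)\<close>. As \<open>c\<^sup>T v\<^sub>i = 1\<close>, the Gram matrix of the vectors \<open>c - v\<^sub>i\<close> has entries
  \<open>v\<^sub>i\<^sup>T v\<^sub>j - 1\<close>, and its trace product with \<open>B\<close> is nonnegative. Since \<open>B\<^sub>i\<^sub>j\<close> or \<open>v\<^sub>i\<^sup>T v\<^sub>j\<close> vanishes for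
  \<open>i \<noteq> j\<close>, this gives \<open>e\<^sup>T B e \<le> \<Sum>\<^sub>i B\<^sub>i\<^sub>i / (c\<^sup>T u\<^sub>i)\<^sup>2\<close>.
\<close>

lemma quadratic_form_eq_sum:
  fixes B :: "real ^ 'n::finite ^ 'n"
  shows "x \<bullet> (B *v x) = (\<Sum>i\<in>UNIV. \<Sum>j\<in>UNIV. B $ i $ j * (x $ i * x $ j))"
  by (simp add: inner_vec_def matrix_vector_mult_def sum_distrib_left mult_ac)

lemma ones_form_eq_sum:
  fixes B :: "real ^ 'n::finite ^ 'n"
  shows "ones_form B = (\<Sum>i\<in>UNIV. \<Sum>j\<in>UNIV. B $ i $ j)"
  by (simp add: ones_form_def quadratic_form_eq_sum)

lemma psd_matrix_diag_nonneg:
  fixes B :: "real ^ 'n::finite ^ 'n"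
  assumes "psd_matrix B"
  shows "0 \<le> B $ i $ i"
proof -
  have "0 \<le> axis i 1 \<bullet> (B *v axis i 1)"
    using assms by (auto simp: psd_matrix_def)
  then show ?thesis
    by (simp add: inner_axis' column_def matrix_vector_mul_component inner_axis)
qed

lemma psd_matrix_scaleR:
  fixes B :: "real ^ 'n::finite ^ 'n"
  assumes "psd_matrix B" "0 \<le> r"
  shows "psd_matrix (r *\<^sub>R B)"
  using assms by (simp add: psd_matrix_def transpose_scalar scaleR_matrix_vector_assoc [symmetric])

lemma trace_scaleR: "trace (r *\<^sub>R B) = r * trace B" for B :: "real ^ 'n::finite ^ 'n"
  by (simp add: trace_def sum_distrib_left)

lemma ones_form_scaleR: "ones_form (r *\<^sub>R B) = r * ones_form B" for B :: "real ^ 'n::finite ^ 'n"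
  by (simp add: ones_form_eq_sum sum_distrib_left)

text \<open>Coordinate by coordinate, the sum splits into quadratic forms of \<open>B\<close>: the
  \<open>m\<close>-th one is taken at the vector of all \<open>m\<close>-th coordinates of the
  \<open>y i\<close>.\<close>

lemma psd_matrix_gram_nonneg:
  fixes B :: "real ^ 'n::finite ^ 'n"
  assumes "psd_matrix B"
  shows "0 \<le> (\<Sum>i\<in>UNIV. \<Sum>j\<in>UNIV. B $ i $ j * inner_dim d (y i) (y j))"
proof -
  have "0 \<le> (\<Sum>m<d. (\<chi> i. y i m) \<bullet> (B *v (\<chi> i. y i m)))"
    using assms by (intro sum_nonneg) (auto simp: psd_matrix_def)
  also have "\<dots> = (\<Sum>m<d. \<Sum>i\<in>UNIV. \<Sum>j\<in>UNIV. B $ i $ j * (y i m * y j m))"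
    by (simp add: quadratic_form_eq_sum)
  also have "\<dots> = (\<Sum>i\<in>UNIV. \<Sum>m<d. \<Sum>j\<in>UNIV. B $ i $ j * (y i m * y j m))"
    by (rule sum.swap)
  also have "\<dots> = (\<Sum>i\<in>UNIV. \<Sum>j\<in>UNIV. \<Sum>m<d. B $ i $ j * (y i m * y j m))"
    by (intro sum.cong refl sum.swap)
  finally show ?thesis
    by (simp add: inner_dim_def sum_distrib_left)
qed

lemma ones_form_le_sum_diag:
  fixes B :: "real ^ 'n::finite ^ 'n"
  assumes rep: "orthonormal_rep H d u"
    and c: "unit_dim d c"
    and nz: "\<And>i. inner_dim d c (u i) \<noteq> 0"
    and B: "psd_matrix B" "\<And>i j. H i j \<Longrightarrow> B $ i $ j = 0"
  shows "ones_form B \<le> (\<Sum>i\<in>UNIV. B $ i $ i / (inner_dim d c (u i))\<^sup>2)"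
proof -
  define a where "a i = inner_dim d c (u i)" for i
  have a: "a i \<noteq> 0" for i
    using nz by (simp add: a_def)
  have cc: "inner_dim d c c = 1"
    using c by (simp add: unit_dim_def)
  have uu: "inner_dim d (u i) (u i) = 1" for i
    using rep by (simp add: orthonormal_rep_def unit_dim_def)
  have gram: "inner_dim d (\<lambda>m. c m - u i m / a i) (\<lambda>m. c m - u j m / a j)
      = inner_dim d (u i) (u j) / (a i * a j) - 1" for i j
  proof -
    have "inner_dim d (\<lambda>m. c m - u i m / a i) (\<lambda>m. c m - u j m / a j)
        = inner_dim d c c - inner_dim d c (u i) / a i - inner_dim d c (u j) / a j
          + inner_dim d (u i) (u j) / (a i * a j)"
      by (simp add: inner_dim_def sum_divide_distrib flip: sum_subtractf sum.distrib)
        (rule sum.cong, simp_all add: algebra_simps)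
    then show ?thesis
      using a[of i] a[of j] by (simp add: cc flip: a_def)
  qed
  \<comment> \<open>If \<open>H i j\<close>, then the entry of \<open>B\<close> vanishes, even at a
    loop \<open>i = j\<close>, where both sides become 0. Otherwise orthogonality settles
    \<open>i \<noteq> j\<close>, and the unit length of \<open>u i\<close> settles
    \<open>i = j\<close>.\<close>
  have off: "B $ i $ j * (inner_dim d (u i) (u j) / (a i * a j))
      = (if j = i then B $ i $ i / (a i)\<^sup>2 else 0)" for i j
    using rep B(2)[of i j] uu[of i]
    by (cases "H i j") (auto simp: orthonormal_rep_def power2_eq_square)
  have "0 \<le> (\<Sum>i\<in>UNIV. \<Sum>j\<in>UNIV. B $ i $ j * (inner_dim d (u i) (u j) / (a i * a j) - 1))"
    using psd_matrix_gram_nonneg[OF B(1), of d "\<lambda>i m. c m - u i m / a i"] by (simp only: gram)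
  also have "\<dots> = (\<Sum>i\<in>UNIV. \<Sum>j\<in>UNIV. (if j = i then B $ i $ i / (a i)\<^sup>2 else 0) - B $ i $ j)"
    by (simp only: right_diff_distrib off mult_1_right)
  also have "\<dots> = (\<Sum>i\<in>UNIV. B $ i $ i / (a i)\<^sup>2) - ones_form B"
    by (simp add: sum_subtractf ones_form_eq_sum)
  finally show ?thesis
    by (simp add: a_def)
qed

lemma ones_form_le_rep_value:
  fixes B :: "real ^ 'n::finite ^ 'n"
  assumes rep: "orthonormal_rep H d u"
    and B: "psd_matrix B" "trace B = 1" "\<And>i j. H i j \<Longrightarrow> B $ i $ j = 0"
  shows "ereal (ones_form B) \<le> rep_value d u"
  unfolding rep_value_def
proof (rule INF_greatest)
  fix c assume "c \<in> {c. unit_dim d c}"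
  then have c: "unit_dim d c" by simp
  let ?M = "MAX i\<in>UNIV. 1 / ereal ((inner_dim d c (u i))\<^sup>2)"
  have le: "1 / ereal ((inner_dim d c (u i))\<^sup>2) \<le> ?M" for i
    by (rule Max_ge) auto
  show "ereal (ones_form B) \<le> ?M"
  proof (cases ?M)
    case (real t)
    \<comment> \<open>A zero inner product would contribute \<open>1 / 0 = \<infinity>\<close> to
      the finite maximum.\<close>
    have nz: "inner_dim d c (u i) \<noteq> 0" for i
      using le[of i] unfolding real by (auto simp: divide_ereal_def zero_ereal_def [symmetric])
    have t: "1 / (inner_dim d c (u i))\<^sup>2 \<le> t" for i
      using le[of i] nz[of i] unfolding real by (simp add: one_ereal_def)
    have "ones_form B \<le> (\<Sum>i\<in>UNIV. B $ i $ i / (inner_dim d c (u i))\<^sup>2)"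
      by (rule ones_form_le_sum_diag[OF rep c nz B(1) B(3)])
    \<comment> \<open>The diagonal entries are nonnegative weights of sum
      \<open>trace B = 1\<close>, so the weighted average is at most the maximum
      \<open>t\<close>.\<close>
    also have "\<dots> \<le> (\<Sum>i\<in>UNIV. B $ i $ i * t)"
      using mult_left_mono[OF t psd_matrix_diag_nonneg[OF B(1)]] by (intro sum_mono) simp
    also have "\<dots> = t"
      using B(2) by (simp add: trace_def flip: sum_distrib_right)
    finally show ?thesis
      using real by simp
  next
    \<comment> \<open>Impossible, as every term of the maximum is nonnegative;
      \<open>undefined\<close> serves as an arbitrary vertex.\<close>
    case MInf
    have "0 \<le> 1 / ereal ((inner_dim d c (u undefined))\<^sup>2)"
      by simp
    with le[of undefined] MInf show ?thesis
      by simp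
  qed simp
qed

lemma ones_form_le_lovasz_theta:
  fixes B :: "real ^ 'n::finite ^ 'n"
  assumes "psd_matrix B" "trace B = 1" "\<And>i j. H i j \<Longrightarrow> B $ i $ j = 0"
  shows "ones_form B \<le> lovasz_theta H"
proof -
  have "ereal (ones_form B) \<le> ereal (lovasz_theta H)"
    unfolding ereal_lovasz_theta
    by (rule INF_greatest) (auto intro: ones_form_le_rep_value assms)
  then show ?thesis by simp
qed

lemma graph_dist_le_iff: "graph_dist G i j \<le> enat k \<longleftrightarrow> (\<exists>l\<le>k. (G ^^ l) i j)"
proof -
  \<comment> \<open>The strict form is what yields a witness: an infimum lies strictly below a bound
    iff some element does.\<close>
  have "graph_dist G i j \<le> enat k \<longleftrightarrow> graph_dist G i j < enat (Suc k)"
    by (cases "graph_dist G i j") auto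
  also have "\<dots> \<longleftrightarrow> (\<exists>l\<le>k. (G ^^ l) i j)"
    by (auto simp: graph_dist_def INF_less_iff less_Suc_eq_le)
  finally show ?thesis .
qed

text \<open>A nonzero entry of the power needs a nonzero product of entries of \<open>A\<close>
  along \<open>l\<close> steps. A diagonal entry of \<open>A\<close> is a step that stays in place,
  hence a walk of length at most \<open>l\<close> rather than exactly \<open>l\<close>.\<close>

lemma matrix_power_nonzero_walk:
  assumes "A \<in> graph_matrices G" "matrix_power A l $ i $ j \<noteq> 0"
  shows "\<exists>m\<le>l. (G ^^ m) i j"
  using assms(2)
proof (induction l arbitrary: i)
  case 0
  then show ?case
    by (auto simp: mat_def split: if_splits)
next
  case (Suc l)
  then have "(\<Sum>h\<in>UNIV. A $ i $ h * matrix_power A l $ h $ j) \<noteq> 0"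
    by (simp add: matrix_matrix_mult_def)
  then obtain h where h: "A $ i $ h \<noteq> 0" "matrix_power A l $ h $ j \<noteq> 0"
    by (metis (no_types, lifting) mult_eq_0_iff sum.neutral)
  obtain m where m: "m \<le> l" "(G ^^ m) h j"
    using Suc.IH[OF h(2)] by blast
  have "graph_dist G i h \<le> enat 1"
    using assms(1) h(1) by (force simp: graph_matrices_def one_enat_def not_less)
  then have "i = h \<or> G i h"
    by (auto simp: graph_dist_le_iff le_Suc_eq)
  then show ?case
  proof
    assume "i = h"
    with m show ?thesis by (auto intro: le_SucI)
  next
    assume "G i h"
    with m have "(G ^^ Suc m) i j" by (blast intro: relpowp_Suc_I2)
    with m show ?thesis by (meson Suc_le_mono)
  qed
qed

text \<open>Only powers of \<open>A\<close> up to \<open>k\<close> occur in the polynomial, and none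
  of them has a nonzero entry at a pair more than \<open>k\<close> apart.\<close>

lemma poly_matrix_complement_power_eq_0:
  assumes "A \<in> graph_matrices G" "degree p \<le> k" "graph_complement (graph_power G k) i j"
  shows "poly_matrix p A $ i $ j = 0"
proof -
  have "\<not> graph_dist G i j \<le> enat k"
    using assms(3) by (auto simp: graph_complement_def graph_power_def)
  then have "matrix_power A l $ i $ j = 0" if "l \<le> k" for l
    using matrix_power_nonzero_walk[OF assms(1)] that by (meson graph_dist_le_iff le_trans)
  then show ?thesis
    using assms(2) by (simp add: poly_matrix_def)
qed

theorem theorem7:
  fixes G :: "'n::finite \<Rightarrow> 'n \<Rightarrow> bool"
    and A :: "real ^ 'n ^ 'n"
    and p :: "real poly"
    and k :: nat
  assumes "k \<ge> 1"
    and "simple_graph G"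
    and "A \<in> graph_matrices G"
    and "degree p \<le> k"
    and "psd_matrix (poly_matrix p A)"
    and "trace (poly_matrix p A) > 0"
  shows "lovasz_theta (graph_complement (graph_power G k))
           \<ge> ones_form (poly_matrix p A) / trace (poly_matrix p A) \<and>
         (nonneg_matrix (poly_matrix p A) \<longrightarrow>
           schrijver_theta (graph_complement (graph_power G k))
             \<ge> ones_form (poly_matrix p A) / trace (poly_matrix p A))"
proof -
  let ?H = "graph_complement (graph_power G k)"
  let ?P = "poly_matrix p A"
  define B where "B = (1 / trace ?P) *\<^sub>R ?P"
  have psd: "psd_matrix B"
    unfolding B_def using assms(5,6) by (intro psd_matrix_scaleR) auto
  have tr: "trace B = 1"
    using assms(6) by (simp add: B_def trace_scaleR)
  have zero: "B $ i $ j = 0" if "?H i j" for i j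
    using poly_matrix_complement_power_eq_0[OF assms(3,4) that] by (simp add: B_def)
  have ones: "ones_form B = ones_form ?P / trace ?P"
    by (simp add: B_def ones_form_scaleR)
  have "ones_form B \<le> lovasz_theta ?H"
    using psd tr zero by (rule ones_form_le_lovasz_theta)
  moreover have "ones_form B \<le> schrijver_theta ?H" if "nonneg_matrix ?P"
  proof -
    have "nonneg_matrix B"
      using that assms(6) by (simp add: B_def nonneg_matrix_def)
    with psd tr zero have "B \<in> schrijver_feasible ?H"
      by (simp add: schrijver_feasible_def)
    \<comment> \<open>A supremum of reals dominates its elements only if the set is bounded above,
      hence \<open>schrijver_bdd_above\<close>.\<close>
    then show ?thesis
      unfolding schrijver_theta_def by (rule cSUP_upper[OF _ schrijver_bdd_above])
  qed
  ultimately show ?thesis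
    by (simp add: ones)
qed

end
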